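(* For every integer $j$, every $n\ge0$ and every $m\in\{0,1,2,3,4\}$: (i) $\bar P_j(m,5,5n)=\tfrac15\bar p_j(5n)$ if $j\equiv1,2\pmod5$; (ii) $\bar P_j(m,5,5n+1)=\tfrac15\bar p_j(5n+1)$ if $j\not\equiv1,2\pmod5$; (iii) $\bar P_j(m,5,5n+2)=\tfrac15\bar p_j(5n+2)$ if $j\not\equiv0,3\pmod5$; (iv) $\bar P_j(m,5,5n+3)=\tfrac15\bar p_j(5n+3)$ if $j\equiv0,3\pmod5$; (v) $\bar P_j(m,5,5n+4)=\tfrac15\bar p_j(5n+4)$ for all $j$.
   Context: For a partition $\pi=(\lambda_1\ge\cdots\ge\lambda_\nu>0)$, $\mathrm{BG\text{-}rank}(\pi)=\sum_{j=1}^{\nu}(-1)^{j+1}\mathrm{par}(\lambda_j)$, where $\mathrm{par}(m)=1$ if $m$ is odd and $0$ if $m$ is even. $\nu(\pi)$ denotes the number of parts. 2-quotient: for $\pi$ let $S=\{\lambda_j-j:j\ge1\}$ (with $\lambda_j=0$ for $j>\nu$), $S_c=\{k\in\mathbb Z:2k+c\in S\}$ for $c=0,1$, and let $\hat\pi_c$ be the partition whose parts are the numbers $\#\{s\in S_c:s>g\}$ for $g\in\mathbb Z\setminus S_c$ (finitely many positive). $\text{2-quotient-rank}(\pi)=\nu(\hat\pi_0)-\nu(\hat\pi_1)$. $\bar p_j(n)$ is the number of partitions of $n$ with BG-rank equal to $j$, and $\bar P_j(m,5,n)$ is the number of partitions of $n$ with BG-rank equal to $j$ and 2-quotient-rank $\equiv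 m\pmod5$. *)

theory Defs
  imports Complex_Main "HOL-Library.Multiset"
begin

definition is_partition :: "nat list \<Rightarrow> bool" where
  "is_partition xs \<longleftrightarrow> sorted_wrt (\<ge>) xs \<and> (\<forall>x\<in>set xs. 0 < x)"

definition partitions :: "nat \<Rightarrow> nat list set" where
  "partitions n = {xs. is_partition xs \<and> sum_list xs = n}"

definition part :: "nat list \<Rightarrow> nat \<Rightarrow> nat" where
  "part xs j = (if 1 \<le> j \<and> j \<le> length xs then xs ! (j - 1) else 0)"

definition par :: "nat \<Rightarrow> int" where
  "par m = (if odd m then 1 else 0)"

definition bg_rank :: "nat list \<Rightarrow> int" where
  "bg_rank xs = (\<Sum>j = 1..length xs. (-1) ^ (j + 1) * par (part xs j))"

definition beta_set :: "nat list \<Rightarrow> int set" where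
  "beta_set xs = {int (part xs j) - int j | j. 1 \<le> j}"

definition S_c :: "nat list \<Rightarrow> int \<Rightarrow> int set" where
  "S_c xs c = {k. 2 * k + c \<in> beta_set xs}"

text \<open>The indices g not in S_c giving positive parts #{s in S_c. s > g} of the
  quotient partition hat-pi_c; the number of parts nu(hat-pi_c) is the number of such g.\<close>
definition quot_part_index :: "nat list \<Rightarrow> int \<Rightarrow> int set" where
  "quot_part_index xs c = {g. g \<notin> S_c xs c \<and> 0 < card {s \<in> S_c xs c. g < s}}"

definition quot_parts :: "nat list \<Rightarrow> int \<Rightarrow> nat multiset" where
  "quot_parts xs c = image_mset (\<lambda>g. card {s \<in> S_c xs c. g < s}) (mset_set (quot_part_index xs c))"

definition quot_nu :: "nat list \<Rightarrow> int \<Rightarrow> nat" where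
  "quot_nu xs c = size (quot_parts xs c)"

definition two_quotient_rank :: "nat list \<Rightarrow> int" where
  "two_quotient_rank xs = int (quot_nu xs 0) - int (quot_nu xs 1)"

definition pbar :: "int \<Rightarrow> nat \<Rightarrow> nat" where
  "pbar j n = card {xs \<in> partitions n. bg_rank xs = j}"

definition Pbar :: "int \<Rightarrow> int \<Rightarrow> nat \<Rightarrow> nat" where
  "Pbar j m n = card {xs \<in> partitions n. bg_rank xs = j \<and> two_quotient_rank xs mod 5 = m mod 5}"

end

theory Submission
  imports Defs "HOL-Computational_Algebra.Formal_Power_Series"
begin

text \<open>
  Fix an even \<open>L = 2M\<close> and read a partition as the set of its \<open>L\<close> largest beta numbers, shifted to
  be nonnegative. The even and the odd members of this set, halved, are two finite sets \<open>Y\<close>, \<open>Z\<close> of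
  natural numbers; BG-rank \<open>j\<close> means \<open>|Y| = M + j\<close>, \<open>|Z| = M - j\<close>, and the 2-quotient-rank is the
  number of gaps below the maximum of \<open>Y\<close> minus that of \<open>Z\<close>. Hence, with \<open>n = 2N + j(2j-1)\<close> and \<open>z\<close>
  marking the 2-quotient-rank, partitions are counted by the coefficient of \<open>q^N\<close> in
  \<open>1 / ((zq;q) (q/z;q))\<close> once \<open>L\<close> is large. For a nontrivial fifth root of unity \<open>z\<close> this is
  \<open>(q;q) (z^2 q;q) (q/z^2;q) / (q^5;q^5)\<close>, whose numerator is, by the Jacobi triple product, a
  combination of powers \<open>q^(k(k+1)/2)\<close> in which the terms with \<open>k = 2 (mod 5)\<close> vanish. So only \<open>N\<close>
  congruent to \<open>0\<close> or \<open>1\<close> modulo \<open>5\<close> survive, and for all other \<open>N\<close> the 2-quotient-rank is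
  equidistributed modulo \<open>5\<close>.
\<close>

unbundle fps_syntax

section \<open>A finite triple product identity\<close>

definition qprod :: "'a::comm_ring_1 \<Rightarrow> nat \<Rightarrow> 'a fps" where
  "qprod z n = (\<Prod>i=1..n. 1 - fps_const z * fps_X ^ i)"

lemma qprod_0 [simp]: "qprod z 0 = 1"
  by (simp add: qprod_def)

lemma qprod_Suc: "qprod z (Suc n) = qprod z n * (1 - fps_const z * fps_X ^ Suc n)"
  by (simp add: qprod_def)

lemma qprod_nth_0 [simp]: "qprod z n $ 0 = 1"
  by (induction n) (simp_all add: qprod_Suc)

text \<open>Each additional factor is 1 modulo \<open>X^(n+1)\<close>. An explicit cofactor
  \<open>h\<close> turns the congruence into an equation that can be multiplied and
  cancelled.\<close>

lemma qprod_add_cong: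
  "\<exists>h. qprod z (n + m) = qprod z n * (1 + fps_X ^ Suc n * h)"
proof (induction m)
  case 0
  show ?case by (rule exI[of _ 0]) simp
next
  case (Suc m)
  then obtain h where h: "qprod z (n + m) = qprod z n * (1 + fps_X ^ Suc n * h)" by blast
  have "qprod z (n + Suc m) = qprod z n * (1 + fps_X ^ Suc n *
      (h - fps_const z * fps_X ^ m * (1 + fps_X ^ Suc n * h)))"
    using qprod_Suc[of z "n + m"] by (simp add: h) (simp add: algebra_simps power_add)
  then show ?case by blast
qed

text \<open>These are the Chebyshev polynomials of the fourth kind at \<open>u/2\<close>. The
  recursion mentions only \<open>u\<close>, so it serves scalars and constant power series
  alike.\<close>

fun chi :: "'a::comm_ring_1 \<Rightarrow> nat \<Rightarrow> 'a" where
  "chi u 0 = 1"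
| "chi u (Suc 0) = 1 + u"
| "chi u (Suc (Suc k)) = u * chi u (Suc k) - chi u k"

lemma fps_const_chi: "fps_const (chi u k) = chi (fps_const u) k"
  by (induction u k rule: chi.induct) (simp_all flip: fps_const_add fps_const_mult fps_const_sub)

text \<open>The equation for \<open>u\<close> holds when \<open>u = z + 1/z\<close> with
  \<open>z\<close> a primitive fifth root of unity. It makes the sequence \<open>chi u\<close>
  periodic with period 5, and \<open>chi u 2 = u^2 + u - 1\<close> vanishes.\<close>

lemma chi_eq_0:
  assumes "u * u = 1 - u" and "k mod 5 = 2"
  shows "chi u k = 0"
proof -
  have *: "u * (u * x) = x - u * x" for x
    using assms(1) by (metis left_diff_distrib mult.assoc mult_1)
  have 2: "chi u 2 = 0"
    using assms(1) by (simp add: numeral_2_eq_2 algebra_simps)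
  have "chi u (Suc (Suc (Suc (Suc (Suc k))))) = chi u k" for k
    by (simp add: algebra_simps *)
  then have "chi u (5 * i + 2) = 0" for i
    by (induction i) (use 2 in \<open>simp_all add: eval_nat_numeral del: chi.simps\<close>)
  from this[of "k div 5"] assms(2) show ?thesis
    by (metis mult_div_mod_eq)
qed

text \<open>Summation by parts: the coefficient of \<open>t k\<close> is \<open>-(-1)^k\<close>
  times \<open>chi u (k+1) + chi u (k-1)\<close>, which the recursion turns into
  \<open>u * chi u k\<close>. At \<open>k = 0\<close> truncated subtraction makes \<open>t 0\<close>
  its own left neighbour, which fits \<open>chi u 1 = 1 + u\<close>.\<close>

lemma chi_three_term_sum:
  "(\<Sum>k\<le>n. (-1) ^ k * chi u k * (t (k - 1) + t (Suc k))) =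
     - u * (\<Sum>k\<le>n. (-1) ^ k * chi u k * t k)
       + (-1) ^ n * (chi u n * t (Suc n) + chi u (Suc n) * t n)"
  by (induction n) (simp_all add: algebra_simps)

text \<open>The Gaussian binomial coefficient with upper entry \<open>2K+1\<close> and lower entry \<open>K-k\<close>.\<close>
definition qbin :: "nat \<Rightarrow> nat \<Rightarrow> 'a::field fps" where
  "qbin K k = (if k \<le> K then qprod 1 (2*K+1) * inverse (qprod 1 (Suc K + k) * qprod 1 (K - k)) else 0)"

section \<open>Recursion for the Gaussian binomial coefficients\<close>

lemma qbin_mult:
  assumes "k \<le> K"
  shows "qbin K k * (qprod 1 (Suc K + k) * qprod 1 (K - k)) = qprod 1 (2*K+1)"
  using assms inverse_mult_eq_1[of "qprod (1::'a) (Suc K + k) * qprod 1 (K - k)"]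
  by (simp add: qbin_def mult.assoc)

lemma fps_unit_cancel:
  fixes f g h :: "'a::field fps"
  assumes "f * h = g * h" "h $ 0 \<noteq> 0"
  shows "f = g"
  using assms by auto

lemma qbin_diag: "qbin K K = 1"
  by (rule fps_unit_cancel[OF trans[OF qbin_mult]]) (simp_all add: mult_2)

text \<open>Two q-Pascal steps raise the upper entry from \<open>2K+1\<close> to
  \<open>2K+3\<close>. The neighbour at index -1 equals the one at 0 by symmetry of the binomial,
  hence the separate case. Clearing denominators with \<open>?P\<close> leaves the polynomial
  identity \<open>id\<close> in \<open>X\<close> and \<open>x\<close>.\<close>

lemma qbin_Suc_0:
  "qbin (Suc K) 0 = (1 + fps_X ^ (2*K+2)) * qbin K 0 + fps_X ^ Suc K * (qbin K 0 + fps_X * qbin K 1)"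
proof (rule fps_unit_cancel)
  let ?P = "qprod (1::'a) (Suc (Suc K)) * qprod 1 (Suc K)"
  let ?Q = "qprod (1::'a) (2*K+1)"
  define X where "X = (fps_X :: 'a fps)"
  define x where "x = X ^ K"
  have xx: "X ^ (2 * K) = x * x" "X ^ (K * 2) = x * x"
    by (simp_all add: x_def mult_2 mult_2_right power_add)
  have Q1: "qprod (1::'a) (Suc K) = qprod 1 K * (1 - X * x)"
    and Q2: "qprod (1::'a) (Suc (Suc K)) = qprod 1 (Suc K) * (1 - X * X * x)"
    and Q3: "qprod (1::'a) (2 * Suc K + 1) = ?Q * ((1 - X * X * x * x) * (1 - X * X * X * x * x))"
    by (simp_all add: qprod_Suc x_def[symmetric] X_def[symmetric] xx mult.assoc)
  show "?P $ 0 \<noteq> 0" by simp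
  have 0: "qbin K 0 * ?P = ?Q * ((1 - X * X * x) * (1 - X * x))"
  proof -
    have "qbin K 0 * ?P = (qbin K 0 * (qprod 1 (Suc K + 0) * qprod 1 (K - 0))) * ((1 - X * X * x) * (1 - X * x))"
      unfolding Q2 by (simp add: Q1 mult_ac)
    then show ?thesis by (subst (asm) qbin_mult) auto
  qed
  have 1: "qbin K 1 * ?P = ?Q * ((1 - X * x) * (1 - x))"
  proof (cases K)
    case 0
    \<comment> \<open>Index 1 is out of range here, so \<open>qbin\<close> is 0, while
      \<open>x = 1\<close> kills the right-hand side.\<close>
    then show ?thesis by (simp add: qbin_def x_def)
  next
    case (Suc K')
    then have "qprod (1::'a) K = qprod 1 (K - 1) * (1 - x)"
      by (simp add: qprod_Suc x_def X_def)
    then have "qbin K 1 * ?P = (qbin K 1 * (qprod 1 (Suc K + 1) * qprod 1 (K - 1))) * ((1 - X * x) * (1 - x))"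
      by (simp add: Q1 mult_ac)
    then show ?thesis using Suc by (subst (asm) qbin_mult) auto
  qed
  have 2: "qbin (Suc K) 0 * ?P = ?Q * ((1 - X * X * x * x) * (1 - X * X * X * x * x))"
    using qbin_mult[of 0 "Suc K", where 'a='a] unfolding Q3 by simp
  have id: "(1 + X * X * x * x) * ((1 - X * X * x) * (1 - X * x))
      + X * x * ((1 - X * X * x) * (1 - X * x) + X * ((1 - X * x) * (1 - x)))
    = (1 - X * X * x * x) * (1 - X * X * X * x * x)"
    by (simp add: algebra_simps)
  have "((1 + fps_X ^ (2*K+2)) * qbin K 0 + fps_X ^ Suc K * (qbin K 0 + fps_X * qbin K 1)) * ?P
     = (1 + X * X * x * x) * (qbin K 0 * ?P) + X * x * (qbin K 0 * ?P + X * (qbin K 1 * ?P))"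
    by (simp add: x_def[symmetric] X_def[symmetric] xx algebra_simps del: One_nat_def)
  also have "\<dots> = qbin (Suc K) 0 * ?P"
    unfolding 0 1 2 id[symmetric] by (simp only: distrib_left distrib_right mult_ac)
  finally show "qbin (Suc K) 0 * ?P = ((1 + fps_X ^ (2*K+2)) * qbin K 0
      + fps_X ^ Suc K * (qbin K 0 + fps_X * qbin K 1)) * ?P" ..
qed

text \<open>The generic form of the same two q-Pascal steps, again by clearing denominators.\<close>

lemma qbin_Suc_Suc:
  assumes "k \<le> K"
  shows "qbin (Suc K) (Suc k) = (1 + fps_X ^ (2*K+2)) * qbin K (Suc k)
     + fps_X ^ (K - k) * qbin K k + fps_X ^ (K + k + 3) * qbin K (Suc (Suc k))"
proof (rule fps_unit_cancel)
  obtain d where K: "K = k + d" using assms le_Suc_ex by blast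
  let ?P = "qprod (1::'a) (Suc K + Suc (Suc k)) * qprod 1 (K - k)"
  let ?Q = "qprod (1::'a) (2*K+1)"
  define X where "X = (fps_X :: 'a fps)"
  define y where "y = X ^ d"
  \<comment> \<open>\<open>A\<close> is \<open>X^(K+k+2)\<close> and \<open>y\<close> is
    \<open>X^(K-k)\<close>. Writing \<open>K = k + d\<close> removes truncated subtraction and
    leaves an identity in \<open>X\<close>, \<open>A\<close> and \<open>y\<close>.\<close>
  define A where "A = X * X * (X ^ k * X ^ k * y)"
  have p: "X ^ (2 * K + 2) = A * y" "X ^ (K + k + 3) = A * X" "X ^ (K - k) = y"
    by (simp_all add: K y_def A_def power_add mult_2 mult_2_right numeral_3_eq_3 mult_ac)
  have Q1: "qprod (1::'a) (Suc K + Suc k) = qprod 1 (Suc K + k) * (1 - A)"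
    and Q2: "qprod (1::'a) (Suc K + Suc (Suc k)) = qprod 1 (Suc K + Suc k) * (1 - X * A)"
    by (simp_all add: qprod_Suc X_def[symmetric] K A_def y_def power_add mult_ac)
  have Q3: "qprod (1::'a) (2 * Suc K + 1) = ?Q * ((1 - A * y) * (1 - X * A * y))"
    using p(1) by (simp add: qprod_Suc X_def[symmetric] mult.assoc)
  show "?P $ 0 \<noteq> 0" by simp
  have 0: "qbin K k * ?P = ?Q * ((1 - A) * (1 - X * A))"
  proof -
    have "qbin K k * ?P = (qbin K k * (qprod 1 (Suc K + k) * qprod 1 (K - k))) * ((1 - A) * (1 - X * A))"
      unfolding Q2 Q1 by (simp add: K mult_ac)
    then show ?thesis by (subst (asm) qbin_mult) (use assms in auto)
  qed
  have 1: "qbin K (Suc k) * ?P = ?Q * ((1 - X * A) * (1 - y))"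
  proof (cases d)
    case 0
    then show ?thesis by (simp add: qbin_def K y_def)
  next
    case (Suc d')
    then have "qprod (1::'a) (K - k) = qprod 1 (K - Suc k) * (1 - y)"
      by (simp add: qprod_Suc y_def X_def K)
    then have "qbin K (Suc k) * ?P = (qbin K (Suc k) * (qprod 1 (Suc K + Suc k) * qprod 1 (K - Suc k)))
        * ((1 - X * A) * (1 - y))"
      unfolding Q2 by (simp only: mult_ac)
    then show ?thesis by (subst (asm) qbin_mult) (use Suc K in auto)
  qed
  \<comment> \<open>The extra factor \<open>X\<close> avoids the exponent \<open>d - 1\<close>,
    since \<open>X - y\<close> stands for \<open>X (1 - X^(d-1))\<close>. For \<open>d = 0\<close>
    and \<open>d = 1\<close> both sides are 0, because \<open>y\<close> is 1 or
    \<open>X\<close>.\<close>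
  have 2: "X * (qbin K (Suc (Suc k)) * ?P) = ?Q * ((1 - y) * (X - y))"
  proof (cases "d \<ge> 2")
    case False
    then have "d = 0 \<or> d = 1" by auto
    then show ?thesis by (auto simp add: qbin_def K y_def)
  next
    case True
    then obtain d' where d: "d = Suc (Suc d')" by (metis add_2_eq_Suc le_Suc_ex)
    then have *: "qprod (1::'a) (K - k) = qprod 1 (K - Suc (Suc k)) * (1 - X ^ Suc d') * (1 - y)"
      by (simp add: qprod_Suc y_def X_def K)
    have **: "X - y = X * (1 - X ^ Suc d')" by (simp add: y_def d algebra_simps)
    have "X * (qbin K (Suc (Suc k)) * ?P) = (qbin K (Suc (Suc k)) * (qprod 1 (Suc K + Suc (Suc k))
        * qprod 1 (K - Suc (Suc k)))) * ((1 - y) * (X - y))"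
      unfolding * ** by (simp only: mult_ac)
    then show ?thesis by (subst (asm) qbin_mult) (use d K in auto)
  qed
  have 3: "qbin (Suc K) (Suc k) * ?P = ?Q * ((1 - A * y) * (1 - X * A * y))"
    using qbin_mult[of "Suc k" "Suc K", where 'a='a] assms unfolding Q3 by (simp add: K)
  have id: "(1 + A * y) * ((1 - X * A) * (1 - y)) + y * ((1 - A) * (1 - X * A)) + A * ((1 - y) * (X - y))
    = (1 - A * y) * (1 - X * A * y)"
    by (simp add: algebra_simps)
  have "((1 + fps_X ^ (2*K+2)) * qbin K (Suc k)
     + fps_X ^ (K - k) * qbin K k + fps_X ^ (K + k + 3) * qbin K (Suc (Suc k))) * ?P
     = (1 + A * y) * (qbin K (Suc k) * ?P) + y * (qbin K k * ?P)
       + A * (X * (qbin K (Suc (Suc k)) * ?P))"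
    unfolding X_def[symmetric] p by (simp only: distrib_left distrib_right mult_ac)
  also have "\<dots> = qbin (Suc K) (Suc k) * ?P"
    unfolding 0 1 2 3 id[symmetric] by (simp only: distrib_left distrib_right mult_ac)
  finally show "qbin (Suc K) (Suc k) * ?P = ((1 + fps_X ^ (2*K+2)) * qbin K (Suc k)
     + fps_X ^ (K - k) * qbin K k + fps_X ^ (K + k + 3) * qbin K (Suc (Suc k))) * ?P" ..
qed

section \<open>The finite Jacobi triple product\<close>

definition theta_term :: "nat \<Rightarrow> nat \<Rightarrow> 'a::field fps" where
  "theta_term K k = fps_X ^ (k * (k + 1) div 2) * qbin K k"

lemma theta_term_eq_0 [simp]: "k > K \<Longrightarrow> theta_term K k = 0"
  by (simp add: theta_term_def qbin_def)

text \<open>The triangular exponent replaces the unequal powers in \<open>qbin_Suc_Suc\<close> by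
  the common factor \<open>X^(K+1)\<close>, as summation by parts requires. At \<open>k = 0\<close>
  the truncated \<open>k - 1\<close> agrees with the reflection of \<open>k\<close> to
  \<open>-1-k\<close>, which preserves triangular numbers and binomials.\<close>

lemma theta_term_Suc:
  "theta_term (Suc K) k = (1 + fps_X ^ (2*K+2)) * theta_term K k
     + fps_X ^ Suc K * (theta_term K (k - 1) + theta_term K (Suc k))"
proof -
  define T :: "nat \<Rightarrow> nat" where "T k = k * (k + 1) div 2" for k
  have T: "T (Suc k) = T k + Suc k" for k by (simp add: T_def)
  have t: "theta_term K k = fps_X ^ T k * (qbin K k :: 'a fps)" for K k
    by (simp add: theta_term_def T_def)
  consider "k = 0" | l where "k = Suc l" "l \<le> K" | "k > Suc K" by (cases k) force+
  then show ?thesis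
  proof cases
    case 1
    then show ?thesis
      using qbin_Suc_0[of K, where 'a='a] by (simp add: theta_term_def)
  next
    case (2 l)
    have "T l + Suc K = T k + (K - l)" "T (Suc k) + Suc K = T k + (K + l + 3)"
      using 2 by (simp_all add: T)
    then have p: "fps_X ^ Suc K * fps_X ^ T l = (fps_X ^ T k * fps_X ^ (K - l) :: 'a fps)"
      "fps_X ^ Suc K * fps_X ^ T (Suc k) = (fps_X ^ T k * fps_X ^ (K + l + 3) :: 'a fps)"
      by (simp_all only: power_add[symmetric] add.commute[of "Suc K"])
    have "fps_X ^ Suc K * (theta_term K (k - 1) + theta_term K (Suc k)) =
      (fps_X ^ Suc K * fps_X ^ T l) * qbin K l + (fps_X ^ Suc K * fps_X ^ T (Suc k)) * (qbin K (Suc k) :: 'a fps)"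
      by (simp only: t 2 distrib_left mult.assoc diff_Suc_1)
    also have "\<dots> = fps_X ^ T k * (fps_X ^ (K - l) * qbin K l + fps_X ^ (K + l + 3) * qbin K (Suc k))"
      unfolding p by (simp only: distrib_left mult_ac)
    finally show ?thesis
      using qbin_Suc_Suc[OF 2(2), where 'a='a]
      unfolding t 2(1) by (simp only: distrib_left distrib_right mult_ac add_ac)
  next
    case 3
    then show ?thesis by simp
  qed
qed

text \<open>A finite form of the Jacobi triple product, with \<open>u = z + 1/z\<close> and
  \<open>chi u k = z^(-k) + \<dots> + z^k\<close>.\<close>
lemma finite_triple_product:
  fixes u :: "'a::field"
  shows "(\<Prod>i=1..K. 1 - fps_const u * fps_X ^ i + fps_X ^ (2*i)) =
    (\<Sum>k\<le>K. (-1) ^ k * chi (fps_const u) k * theta_term K k)"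
proof (induction K)
  case 0
  then show ?case by (simp add: theta_term_def qbin_diag)
next
  case (Suc K)
  let ?c = "\<lambda>k. (-1) ^ k * chi (fps_const u) k"
  have "(\<Sum>k\<le>Suc K. ?c k * theta_term (Suc K) k) =
      (1 + fps_X ^ (2*K+2)) * (\<Sum>k\<le>Suc K. ?c k * theta_term K k)
      + fps_X ^ Suc K * (\<Sum>k\<le>Suc K. ?c k * (theta_term K (k - 1) + theta_term K (Suc k)))"
    unfolding sum_distrib_left sum.distrib[symmetric]
    by (intro sum.cong refl, subst theta_term_Suc) (simp add: distrib_left mult_ac del: chi.simps power_Suc)
  \<comment> \<open>The boundary terms of the summation by parts vanish because
    \<open>theta_term K\<close> is 0 at \<open>K + 1\<close> and \<open>K + 2\<close>.\<close>
  also have "(\<Sum>k\<le>Suc K. ?c k * (theta_term K (k - 1) + theta_term K (Suc k)))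
      = - fps_const u * (\<Sum>k\<le>Suc K. ?c k * theta_term K k)"
    by (subst chi_three_term_sum) simp
  finally show ?case
    using Suc by (simp add: algebra_simps del: fps_const_neg)
qed

text \<open>As \<open>K\<close> grows the binomial tends to \<open>1/(q;q)\<close>, at an explicit
  rate: the quotients of \<open>qprod 1 (2K+1)\<close> by \<open>qprod 1 (K+k+1)\<close> and of
  \<open>qprod 1 K\<close> by \<open>qprod 1 (K-k)\<close> are 1 modulo \<open>X^(K+k+2)\<close> and
  \<open>X^(K-k+1)\<close>.\<close>

lemma qbin_qprod_cong:
  assumes "k \<le> K"
  shows "\<exists>h. qbin K k * qprod 1 K = 1 + fps_X ^ Suc (K - k) * h"
proof -
  have "Suc K + k + (K - k) = 2 * K + 1" "K - k + k = K" using assms by auto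
  moreover obtain h1 where "qprod (1::'a) (Suc K + k + (K - k)) = qprod 1 (Suc K + k) * (1 + fps_X ^ Suc (Suc K + k) * h1)"
    using qprod_add_cong by blast
  moreover obtain h2 where "qprod (1::'a) (K - k + k) = qprod 1 (K - k) * (1 + fps_X ^ Suc (K - k) * h2)"
    using qprod_add_cong by blast
  ultimately have h:
    "qprod (1::'a) (2*K+1) = qprod 1 (Suc K + k) * (1 + fps_X ^ Suc (Suc K + k) * h1)"
    "qprod (1::'a) K = qprod 1 (K - k) * (1 + fps_X ^ Suc (K - k) * h2)"
    by (simp_all only:)
  have "Suc (Suc K + k) = Suc (K - k) + (k + Suc k)" using assms by simp
  then have p: "fps_X ^ Suc (Suc K + k) = (fps_X ^ Suc (K - k) * fps_X ^ (k + Suc k) :: 'a fps)"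
    by (simp only: power_add[symmetric])
  let ?P = "qprod (1::'a) (Suc K + k)"
  have "(qbin K k * qprod 1 K) * ?P =
    (qbin K k * (?P * qprod 1 (K - k))) * (1 + fps_X ^ Suc (K - k) * h2)"
    unfolding h(2) by (simp only: mult_ac)
  also have "\<dots> = ((1 + fps_X ^ Suc (Suc K + k) * h1) * (1 + fps_X ^ Suc (K - k) * h2)) * ?P"
    unfolding qbin_mult[OF assms] h(1) by (simp only: mult_ac)
  finally have "qbin K k * qprod 1 K = (1 + fps_X ^ Suc (Suc K + k) * h1) * (1 + fps_X ^ Suc (K - k) * h2)"
    by (rule fps_unit_cancel) simp
  also have "\<dots> = 1 + fps_X ^ Suc (K - k) * (fps_X ^ (k + Suc k) * h1 + h2 + fps_X ^ Suc (Suc K + k) * h1 * h2)"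
    unfolding p by (simp add: algebra_simps)
  finally show ?thesis by blast
qed

lemma triangular_mod_5:
  "k mod 5 \<noteq> 2 \<Longrightarrow> (k * (k + 1) div 2) mod 5 \<in> {0, 1::nat}"
proof -
  assume k: "k mod 5 \<noteq> 2"
  define q r where "q = k div 5" and "r = k mod 5"
  then have kq: "k = 5 * q + r" "r < 5" by simp_all
  define s where "s = k * (k + 1) div 2"
  have s: "2 * s = k * (k + 1)" by (simp add: s_def)
  have "k * (k + 1) = 5 * (q * (5 * q + 2 * r + 1)) + r * (r + 1)"
    by (simp add: kq algebra_simps)
  then have "(2 * s) mod 5 = (r * (r + 1)) mod 5"
    unfolding s by (simp only: mod_mult_self4)
  moreover have "r \<in> {0,1,3,4}" using kq k r_def by auto
  ultimately have "(2 * s) mod 5 \<in> {0, 2}" by auto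
  then show ?thesis unfolding s_def[symmetric] insert_iff empty_iff by presburger
qed

text \<open>After multiplication by \<open>qprod 1 K\<close> the k-th summand of the finite triple
  product is a scalar multiple of \<open>X^T\<close>, with \<open>T\<close> triangular, up to terms
  of degree above \<open>K\<close>. Either \<open>T\<close> is 0 or 1 modulo 5, or
  \<open>chi u k\<close> vanishes.\<close>

lemma triple_product_nth_eq_0:
  fixes u :: "'a::field"
  assumes u: "u * u = 1 - u" and N: "N \<le> K" "N mod 5 \<notin> {0, 1}"
  shows "(qprod 1 K * (\<Prod>i=1..K. 1 - fps_const u * fps_X ^ i + fps_X ^ (2*i))) $ N = 0"
proof -
  have "(qprod 1 K * ((-1) ^ k * chi (fps_const u) k * theta_term K k)) $ N = 0" if k: "k \<le> K" for k
  proof (cases "k mod 5 = 2")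
    case True
    then show ?thesis using chi_eq_0[OF u] by (simp flip: fps_const_chi)
  next
    case False
    define T where "T = k * (k + 1) div 2"
    have T: "T mod 5 \<in> {0, 1}" using triangular_mod_5[OF False] by (simp add: T_def)
    \<comment> \<open>The error term starts in degree \<open>T + K - k + 1\<close>; this bound
      pushes it beyond \<open>K\<close>, hence beyond \<open>N\<close>.\<close>
    have "k \<le> T" unfolding T_def by (cases k) auto
    obtain h where h: "qbin K k * qprod (1::'a) K = 1 + fps_X ^ Suc (K - k) * h"
      using qbin_qprod_cong[OF k] by blast
    have "qprod 1 K * ((-1) ^ k * chi (fps_const u) k * theta_term K k) =
      fps_const ((-1) ^ k * chi u k) * (fps_X ^ T * (qbin K k * qprod 1 K))"
      by (simp add: theta_term_def T_def fps_const_chi fps_const_power[symmetric] mult_ac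
          flip: fps_const_mult fps_const_neg)
    also have "fps_X ^ T * (qbin K k * qprod 1 K) = fps_X ^ T + fps_X ^ (T + Suc (K - k)) * h"
      unfolding h by (simp add: power_add algebra_simps)
    finally have "(qprod 1 K * ((-1) ^ k * chi (fps_const u) k * theta_term K k)) $ N =
        (-1) ^ k * chi u k * ((fps_X ^ T :: 'a fps) $ N + (fps_X ^ (T + Suc (K - k)) * h) $ N)"
      by (simp only: fps_mult_left_const_nth fps_add_nth)
    moreover have "(fps_X ^ (T + Suc (K - k)) * h) $ N = 0"
      using \<open>k \<le> T\<close> k N by (subst fps_X_power_mult_nth) auto
    moreover have "(fps_X ^ T :: 'a fps) $ N = 0"
      using N T by auto
    ultimately show ?thesis by (simp only: add_0_left mult_zero_right)
  qed
  then show ?thesis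
    unfolding finite_triple_product sum_distrib_left by (simp add: fps_sum_nth)
qed

section \<open>Fifth roots of unity\<close>

lemma qprod_pair:
  assumes "(z::'a::field) \<noteq> 0"
  shows "qprod z K * qprod (inverse z) K =
    (\<Prod>i=1..K. 1 - fps_const (z + inverse z) * fps_X ^ i + fps_X ^ (2*i))"
proof -
  have *: "fps_const z * fps_const (inverse z) = 1"
    using assms by (simp add: fps_const_mult)
  have "(1 - fps_const z * fps_X ^ i) * (1 - fps_const (inverse z) * fps_X ^ i) =
     1 - fps_const (z + inverse z) * fps_X ^ i + (fps_const z * fps_const (inverse z)) * fps_X ^ (2*i)" for i
    by (simp add: algebra_simps mult_2 mult_2_right power_add flip: fps_const_add)
  then show ?thesis
    unfolding qprod_def prod.distrib[symmetric] * by simp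
qed

lemma fifth_root_sum_eq_0:
  assumes "z ^ 5 = 1" "(z::'a::field) \<noteq> 1"
  shows "1 + z + z ^ 2 + z ^ 3 + z ^ 4 = 0"
proof -
  have "(1 - z) * (1 + z + z ^ 2 + z ^ 3 + z ^ 4) = 1 - z ^ 5"
    by (simp add: algebra_simps eval_nat_numeral)
  then show ?thesis using assms by simp
qed

text \<open>Dividing by a series in \<open>X^d\<close> does not leave the residue classes modulo
  \<open>d\<close> that carry \<open>g\<close>: in the convolution at \<open>N\<close> only indices
  congruent to \<open>N\<close> survive, and the smaller ones vanish by induction.\<close>

lemma fps_nth_eq_0_if_mult_cong:
  fixes f e g :: "'a::field fps"
  assumes fe: "\<And>i. i \<le> K \<Longrightarrow> (f * e) $ i = g $ i" and e0: "e $ 0 = 1"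
    and e: "\<And>i. i mod d \<noteq> 0 \<Longrightarrow> e $ i = 0"
    and g: "\<And>i. i \<le> K \<Longrightarrow> i mod d \<notin> R \<Longrightarrow> g $ i = 0"
    and N: "N \<le> K" "N mod d \<notin> R"
  shows "f $ N = 0"
  using N
proof (induction N rule: less_induct)
  case (less N)
  have "f $ i * e $ (N - i) = 0" if "i < N" for i
  proof (cases "(N - i) mod d = 0")
    case False
    then show ?thesis using e by simp
  next
    case True
    then obtain c where "N - i = d * c" by auto
    then have "N = i + d * c" using that by simp
    then have "N mod d = i mod d" by simp
    then show ?thesis using less that by simp
  qed
  then have "(\<Sum>i=0..<N. f $ i * e $ (N - i)) = 0" by (intro sum.neutral) auto
  moreover have "(f * e) $ N = (\<Sum>i=0..<N. f $ i * e $ (N - i)) + f $ N * e $ 0"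
    by (simp add: fps_mult_nth sum.last_plus add.commute)
  ultimately show ?case using fe g less.prems e0 by simp
qed

lemma prod_fps_X_power_nth_eq_0:
  assumes "i mod d \<noteq> 0"
  shows "(\<Prod>k=1..n. 1 - fps_X ^ (d * k) :: 'a::comm_ring_1 fps) $ i = 0"
  using assms
proof (induction n arbitrary: i)
  case 0
  then show ?case by (cases "i = 0") auto
next
  case (Suc n)
  have *: "(i - d * Suc n) mod d \<noteq> 0" if "i \<ge> d * Suc n"
  proof -
    have "i mod d = (i - d * Suc n + d * Suc n) mod d" using that by simp
    then show ?thesis using Suc.prems by (metis mod_mult_self2)
  qed
  have "(\<Prod>k=1..Suc n. 1 - fps_X ^ (d * k) :: 'a fps) =
    (\<Prod>k=1..n. 1 - fps_X ^ (d * k)) - fps_X ^ (d * Suc n) * (\<Prod>k=1..n. 1 - fps_X ^ (d * k))"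
    by (simp add: algebra_simps)
  also have "\<dots> $ i = 0"
    using Suc.IH[OF Suc.prems] Suc.IH[OF *] unfolding fps_sub_nth fps_X_power_mult_nth by auto
  finally show ?case .
qed

text \<open>Conjugate factors are paired: \<open>p = a + a^4\<close> and
  \<open>r = a^2 + a^3\<close> have sum and product -1. Over a general ring, \<open>a\<close> may be
  a constant power series and \<open>x\<close> a power of \<open>X\<close>.\<close>

lemma fifth_root_product:
  fixes a x :: "'a::comm_ring_1"
  assumes a: "a ^ 5 = 1" "1 + a + a ^ 2 + a ^ 3 + a ^ 4 = 0"
  shows "(1 - a * x) * (1 - a ^ 4 * x) * ((1 - x) * ((1 - a ^ 2 * x) * (1 - a ^ 3 * x))) = 1 - x ^ 5"
proof -
  define p r where "p = a + a ^ 4" and "r = a ^ 2 + a ^ 3"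
  have pr: "r = -1 - p"
    using a(2) unfolding p_def r_def by (simp add: algebra_simps eq_neg_iff_add_eq_0)
  have "p * r = a ^ 3 + a ^ 4 + a ^ 5 * a + a ^ 5 * a ^ 2"
    by (simp add: p_def r_def algebra_simps flip: power_Suc power_add)
  also have "\<dots> = -1"
    unfolding a(1) using a(2) by (simp add: algebra_simps eq_neg_iff_add_eq_0)
  finally have pp: "p * p = 1 - p" unfolding pr by (simp add: algebra_simps)
  have ppx: "p * (p * y) = y - p * y" for y
    using pp by (simp add: mult.assoc[symmetric] left_diff_distrib)
  have 1: "(1 - a * x) * (1 - a ^ 4 * x) = 1 - p * x + a ^ 5 * (x * x)"
    by (simp add: p_def algebra_simps eval_nat_numeral)
  have 2: "(1 - a ^ 2 * x) * (1 - a ^ 3 * x) = 1 - r * x + a ^ 5 * (x * x)"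
    by (simp add: r_def algebra_simps eval_nat_numeral)
  show ?thesis
    unfolding 1 2 a(1) pr by (simp add: algebra_simps ppx pp eval_nat_numeral)
qed

lemma qprod_fifth_roots:
  fixes z :: "'a::field"
  assumes z: "z ^ 5 = 1" "z \<noteq> 1"
  shows "qprod z n * qprod (inverse z) n * (qprod 1 n * (qprod (z\<^sup>2) n * qprod (inverse (z\<^sup>2)) n))
    = (\<Prod>k=1..n. 1 - fps_X ^ (5 * k))"
proof -
  have inv: "inverse z = z ^ 4" "inverse (z\<^sup>2) = z ^ 3"
    using z by (auto intro!: inverse_unique simp flip: power_Suc power_add)
  have s: "(1 + fps_const z + fps_const z ^ 2 + fps_const z ^ 3 + fps_const z ^ 4) = 0"
    using fifth_root_sum_eq_0[OF z] by (simp add: fps_const_power flip: fps_const_1_eq_1)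
  have "fps_const z ^ 5 = 1" using z by (simp add: fps_const_power)
  from fifth_root_product[OF this s, of "fps_X ^ k" for k] show ?thesis
    unfolding qprod_def prod.distrib[symmetric] inv
    by (simp add: fps_const_power power_mult[symmetric] mult.commute)
qed

text \<open>Modulo \<open>X^(N+1)\<close> both lengths \<open>a\<close> and \<open>b\<close> may be
  replaced by \<open>N\<close>. Multiplying \<open>f\<close> by the series in \<open>X^5\<close>
  from \<open>qprod_fifth_roots\<close> then gives \<open>qprod 1 N\<close> times the triple product
  for \<open>z^2\<close>, and division by a series in \<open>X^5\<close> preserves the vanishing
  classes.\<close>

lemma inverse_qprod_fifth_root_nth_eq_0:
  fixes z :: "'a::field"
  assumes z: "z ^ 5 = 1" "z \<noteq> 1" and N: "N \<le> a" "N \<le> b" "N mod 5 \<notin> {0, 1}"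
    and f: "f * (qprod z a * qprod (inverse z) b) = 1"
  shows "f $ N = 0"
proof -
  let ?e = "qprod z N * qprod (inverse z) N"
  let ?g = "qprod 1 N * (qprod (z\<^sup>2) N * qprod (inverse (z\<^sup>2)) N)"
  have z0: "z \<noteq> 0" using z by auto
  obtain h1 where h1: "qprod z a = qprod z N * (1 + fps_X ^ Suc N * h1)"
    using qprod_add_cong[of z N "a - N"] N by auto
  obtain h2 where h2: "qprod (inverse z) b = qprod (inverse z) N * (1 + fps_X ^ Suc N * h2)"
    using qprod_add_cong[of "inverse z" N "b - N"] N by auto
  define h where "h = h1 + h2 + fps_X ^ Suc N * h1 * h2"
  have "(1 + fps_X ^ Suc N * h1) * (1 + fps_X ^ Suc N * h2) = 1 + fps_X ^ Suc N * h"
    by (simp add: h_def algebra_simps)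
  then have "1 = f * (?e * (1 + fps_X ^ Suc N * h))"
    using f unfolding h1 h2 by (simp only: mult_ac)
  then have "?g = (f * (?e * (1 + fps_X ^ Suc N * h))) * ?g" by simp
  also have "\<dots> = f * (?e * ?g) + fps_X ^ Suc N * (f * (?e * ?g) * h)"
    by (simp only: distrib_left distrib_right mult_ac mult_1_left)
  finally have g: "?g = f * (?e * ?g) + fps_X ^ Suc N * (f * (?e * ?g) * h)" .
  have "(f * (?e * ?g)) $ i = ?g $ i" if "i \<le> N" for i
    using that by (subst (2) g) (simp only: fps_add_nth fps_X_power_mult_nth if_True less_Suc_eq_le add_0_right)
  then have fe: "(f * (\<Prod>k=1..N. 1 - fps_X ^ (5 * k))) $ i = ?g $ i" if "i \<le> N" for i
    using that unfolding qprod_fifth_roots[OF z] by blast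
  let ?u = "z\<^sup>2 + inverse (z\<^sup>2)"
  have inv: "inverse (z\<^sup>2) = z ^ 3"
    using z by (auto intro!: inverse_unique simp flip: power_Suc power_add)
  \<comment> \<open>\<open>z^2\<close> is again a primitive fifth root of unity, so
    \<open>?u\<close> satisfies the quadratic equation of the triple product lemma.\<close>
  have u: "?u * ?u = 1 - ?u"
  proof -
    have "?u * ?u = z ^ 4 + z ^ 5 + z ^ 5 + z ^ 5 * z"
      unfolding inv by (simp add: algebra_simps flip: power_Suc power_add)
    then have "?u * ?u - (1 - ?u) = 1 + z + z\<^sup>2 + z ^ 3 + z ^ 4"
      unfolding z(1) inv by simp
    then show ?thesis using fifth_root_sum_eq_0[OF z] by simp
  qed
  show ?thesis
  proof (rule fps_nth_eq_0_if_mult_cong[OF fe])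
    show "?g $ i = 0" if "i \<le> N" "i mod 5 \<notin> {0, 1}" for i
      using triple_product_nth_eq_0[OF u that] qprod_pair[of "z\<^sup>2" N] z0 by simp
    show "(\<Prod>k=1..N. 1 - fps_X ^ (5 * k) :: 'a fps) $ 0 = 1"
      by (induction N) simp_all
    show "(\<Prod>k=1..N. 1 - fps_X ^ (5 * k) :: 'a fps) $ i = 0" if "i mod 5 \<noteq> 0" for i
      by (rule prod_fps_X_power_nth_eq_0[OF that])
  qed (use N in auto)
qed

section \<open>Finite sets of natural numbers counted by sum and gaps\<close>

text \<open>In the convention of \<open>quot_parts\<close> each of these positions gives one
  positive part, so for a beta set this is the number of parts.\<close>

definition gaps :: "nat set \<Rightarrow> nat" where
  "gaps Y = card {g. g \<notin> Y \<and> (\<exists>s\<in>Y. g < s)}"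

definition sum_sets :: "nat \<Rightarrow> nat \<Rightarrow> nat set set" where
  "sum_sets k n = {Y. finite Y \<and> card Y = k \<and> \<Sum>Y = n}"

lemma finite_sum_sets: "finite (sum_sets k n)"
proof (rule finite_subset)
  show "sum_sets k n \<subseteq> Pow {..n}"
    by (auto simp: sum_sets_def intro: member_le_sum[of _ _ "\<lambda>x. x"])
qed simp

lemma gaps_insert_0_Suc_image: "gaps (insert 0 (Suc ` Y)) = gaps Y"
proof -
  have "{g. g \<notin> insert 0 (Suc ` Y) \<and> (\<exists>s\<in>insert 0 (Suc ` Y). g < s)}
      = Suc ` {g. g \<notin> Y \<and> (\<exists>s\<in>Y. g < s)}" (is "?A = ?B")
  proof (rule set_eqI)
    show "g \<in> ?A \<longleftrightarrow> g \<in> ?B" for g by (cases g) auto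
  qed
  then show ?thesis by (simp add: gaps_def card_image)
qed

text \<open>The shift vacates position 0, which is a gap because some element lies above it.\<close>

lemma gaps_Suc_image:
  assumes "finite Y" "Y \<noteq> {}"
  shows "gaps (Suc ` Y) = Suc (gaps Y)"
proof -
  have "{g. g \<notin> Suc ` Y \<and> (\<exists>s\<in>Suc ` Y. g < s)}
      = insert 0 (Suc ` {g. g \<notin> Y \<and> (\<exists>s\<in>Y. g < s)})" (is "?A = ?B")
  proof (rule set_eqI)
    show "g \<in> ?A \<longleftrightarrow> g \<in> ?B" for g using assms(2) by (cases g) auto
  qed
  moreover have "finite {g. g \<notin> Y \<and> (\<exists>s\<in>Y. g < s)}"
    by (rule finite_subset[of _ "\<Union>s\<in>Y. {..<s}"]) (use assms in auto)
  ultimately show ?thesis by (simp add: gaps_def card_image)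
qed

definition gap_fps :: "'a::comm_ring_1 \<Rightarrow> nat \<Rightarrow> 'a fps" where
  "gap_fps z k = Abs_fps (\<lambda>n. \<Sum>Y\<in>sum_sets k n. z ^ gaps Y)"

lemma gap_fps_0: "gap_fps z 0 = 1"
proof (rule fps_ext)
  fix n
  have "sum_sets 0 n = (if n = 0 then {{}} else {})"
    by (auto simp: sum_sets_def)
  then show "gap_fps z 0 $ n = 1 $ n"
    by (simp add: gap_fps_def gaps_def)
qed

lemma sum_Suc_image: "finite Y \<Longrightarrow> \<Sum>(Suc ` Y) = \<Sum>Y + card Y"
  by (simp add: sum.reindex sum.distrib Suc_eq_plus1 del: add_Suc_right One_nat_def add_2_eq_Suc')

text \<open>The cases are whether 0 is a member. Shifting down lowers the sum by the number of
  shifted elements, \<open>k\<close> or \<open>k + 1\<close>. The guards stop truncated subtraction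
  from admitting spurious sets of sum 0.\<close>

lemma sum_sets_Suc:
  "sum_sets (Suc k) n =
     (\<lambda>Y. insert 0 (Suc ` Y)) ` (if n < k then {} else sum_sets k (n - k)) \<union>
     (`) Suc ` (if n < Suc k then {} else sum_sets (Suc k) (n - Suc k))" (is "_ = ?A \<union> ?B")
proof (intro equalityI subsetI)
  fix Y assume Y: "Y \<in> sum_sets (Suc k) n"
  define Y' where "Y' = {y. Suc y \<in> Y}"
  have Y': "finite Y'"
    using Y finite_vimageI[of Y Suc] by (simp add: sum_sets_def Y'_def vimage_def)
  show "Y \<in> ?A \<union> ?B"
  proof (cases "0 \<in> Y")
    case True
    then have "x \<in> Y \<longleftrightarrow> x \<in> insert 0 (Suc ` Y')" for x
      by (cases x) (auto simp: Y'_def)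
    then have e: "Y = insert 0 (Suc ` Y')" by blast
    with Y have "card Y' = k" "\<Sum>Y' + card Y' = n"
      using Y' by (auto simp: sum_sets_def card_image sum_Suc_image)
    then show ?thesis using Y' by (intro UnI1) (auto simp: e sum_sets_def)
  next
    case False
    then have "x \<in> Y \<longleftrightarrow> x \<in> Suc ` Y'" for x
      by (cases x) (auto simp: Y'_def)
    then have e: "Y = Suc ` Y'" by blast
    with Y have "card Y' = Suc k" "\<Sum>Y' + card Y' = n"
      using Y' by (auto simp: sum_sets_def card_image sum_Suc_image)
    then show ?thesis using Y' by (intro UnI2) (auto simp: e sum_sets_def)
  qed
next
  fix Y assume "Y \<in> ?A \<union> ?B"
  then show "Y \<in> sum_sets (Suc k) n"
    by (auto simp: sum_sets_def card_image sum_Suc_image simp del: sum_eq_0_iff split: if_splits)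
qed

text \<open>Sets containing \<open>0\<close> are shifted down after removing \<open>0\<close>, the others are shifted down as they are.\<close>
lemma gap_fps_Suc:
  "gap_fps z (Suc k) = fps_X ^ k * gap_fps z k + fps_X ^ Suc k * (fps_const z * gap_fps z (Suc k))"
proof (rule fps_ext)
  fix n
  let ?A = "if n < k then {} else sum_sets k (n - k)"
  let ?B = "if n < Suc k then {} else sum_sets (Suc k) (n - Suc k)"
  have inj: "inj_on (\<lambda>Y. insert 0 (Suc ` Y)) ?A" "inj_on ((`) Suc) ?B"
    by (auto simp: inj_on_def)
  have gaps_B: "gaps (Suc ` Y) = Suc (gaps Y)" if "Y \<in> ?B" for Y
    by (rule gaps_Suc_image) (use that in \<open>auto simp: sum_sets_def split: if_splits\<close>)
  have "gap_fps z (Suc k) $ n =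
      (\<Sum>Y\<in>(\<lambda>Y. insert 0 (Suc ` Y)) ` ?A. z ^ gaps Y) + (\<Sum>Y\<in>(`) Suc ` ?B. z ^ gaps Y)"
    unfolding gap_fps_def fps_nth_Abs_fps
    by (subst sum_sets_Suc, rule sum.union_disjoint) (auto simp: finite_sum_sets)
  also have "\<dots> = (\<Sum>Y\<in>?A. z ^ gaps Y) + (\<Sum>Y\<in>?B. z * z ^ gaps Y)"
    unfolding sum.reindex[OF inj(1)] sum.reindex[OF inj(2)] o_def gaps_insert_0_Suc_image
    by (intro arg_cong2[of _ _ _ _ "(+)"] refl sum.cong) (simp_all only: gaps_B power_Suc)
  also have "\<dots> = (fps_X ^ k * gap_fps z k + fps_X ^ Suc k * (fps_const z * gap_fps z (Suc k))) $ n"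
    unfolding fps_add_nth fps_X_power_mult_nth fps_mult_left_const_nth
    by (auto simp: gap_fps_def sum_distrib_left)
  finally show "gap_fps z (Suc k) $ n =
    (fps_X ^ k * gap_fps z k + fps_X ^ Suc k * (fps_const z * gap_fps z (Suc k))) $ n" .
qed

text \<open>Solved for its left-hand side, \<open>gap_fps_Suc\<close> reads
  \<open>(1 - z X^(k+1)) G(k+1) = X^k G(k)\<close>. The exponent is the least possible sum of
  \<open>k\<close> distinct naturals.\<close>

lemma qprod_gap_fps: "qprod z k * gap_fps z k = fps_X ^ (k * (k - 1) div 2)"
proof (induction k)
  case 0
  then show ?case by (simp add: gap_fps_0)
next
  case (Suc k)
  have "qprod z (Suc k) * gap_fps z (Suc k) =
    qprod z k * (gap_fps z (Suc k) - fps_X ^ Suc k * (fps_const z * gap_fps z (Suc k)))"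
    by (simp add: qprod_Suc algebra_simps)
  also have "gap_fps z (Suc k) - fps_X ^ Suc k * (fps_const z * gap_fps z (Suc k)) = fps_X ^ k * gap_fps z k"
    by (subst (1) gap_fps_Suc) simp
  also have "qprod z k * (fps_X ^ k * gap_fps z k) = fps_X ^ (k + k * (k - 1) div 2)"
    unfolding power_add Suc[symmetric] by (simp only: mult_ac)
  also have "k + k * (k - 1) div 2 = Suc k * (Suc k - 1) div 2"
    by (cases k) auto
  finally show ?case .
qed

section \<open>Pairs of sets with prescribed total sum\<close>

definition sum_set_pairs :: "nat \<Rightarrow> nat \<Rightarrow> nat \<Rightarrow> (nat set \<times> nat set) set" where
  "sum_set_pairs a b t = {(Y, Z). finite Y \<and> finite Z \<and> card Y = a \<and> card Z = b \<and> \<Sum>Y + \<Sum>Z = t}"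

lemma sum_set_pairs_eq: "sum_set_pairs a b t = (\<Union>i\<in>{0..t}. sum_sets a i \<times> sum_sets b (t - i))"
  by (auto simp: sum_set_pairs_def sum_sets_def)

lemma gap_fps_mult_nth:
  "(gap_fps z a * gap_fps w b) $ t = (\<Sum>(Y, Z)\<in>sum_set_pairs a b t. z ^ gaps Y * w ^ gaps Z)"
proof -
  have "(\<Sum>(Y, Z)\<in>sum_set_pairs a b t. z ^ gaps Y * w ^ gaps Z) =
    (\<Sum>i=0..t. \<Sum>(Y, Z)\<in>sum_sets a i \<times> sum_sets b (t - i). z ^ gaps Y * w ^ gaps Z)"
    unfolding sum_set_pairs_eq
    by (rule sum.UNION_disjoint) (simp, simp add: finite_sum_sets, auto simp: sum_sets_def)
  then show ?thesis
    by (simp add: fps_mult_nth gap_fps_def sum_product sum.cartesian_product)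
qed

text \<open>Here \<open>N\<close> is the excess of \<open>t\<close> over the least total, and the
  sum is the coefficient of \<open>X^N\<close> in the inverse of
  \<open>qprod z a * qprod (inverse z) b\<close>. Quantifying over \<open>N\<close> also covers
  totals below the least one, where the coefficient is 0.\<close>

lemma sum_gaps_fifth_root_eq_0:
  fixes z :: "'a::field"
  assumes z: "z ^ 5 = 1" "z \<noteq> 1"
    and t: "\<And>N. t = N + (a * (a - 1) div 2 + b * (b - 1) div 2) \<Longrightarrow> N \<le> a \<and> N \<le> b \<and> N mod 5 \<notin> {0, 1}"
  shows "(\<Sum>(Y, Z)\<in>sum_set_pairs a b t. z ^ gaps Y * inverse z ^ gaps Z) = 0"
proof -
  let ?q = "qprod z a * qprod (inverse z) b"
  let ?c = "a * (a - 1) div 2 + b * (b - 1) div 2"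
  define f where "f = inverse ?q"
  have f: "f * ?q = 1" unfolding f_def by (rule inverse_mult_eq_1) simp
  have "gap_fps z a * gap_fps (inverse z) b = (f * ?q) * (gap_fps z a * gap_fps (inverse z) b)"
    by (simp add: f)
  also have "\<dots> = f * ((qprod z a * gap_fps z a) * (qprod (inverse z) b * gap_fps (inverse z) b))"
    by (simp only: mult_ac)
  also have "\<dots> = fps_X ^ ?c * f"
    unfolding qprod_gap_fps by (simp add: power_add mult_ac)
  also have "\<dots> $ t = 0"
  proof (cases "t < ?c")
    case False
    then have "t = (t - ?c) + ?c" by simp
    from inverse_qprod_fifth_root_nth_eq_0[OF z _ _ _ f, of "t - ?c"] t[OF this] False
    show ?thesis by (simp add: fps_X_power_mult_nth)
  qed (simp add: fps_X_power_mult_nth)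
  finally show ?thesis by (simp add: gap_fps_mult_nth)
qed

section \<open>Partitions as sets of beta numbers\<close>

lemma part_Suc: "part xs (Suc i) = (if i < length xs then xs ! i else 0)"
  by (simp add: part_def)

lemma part_antimono:
  assumes "is_partition xs" "i \<le> j"
  shows "part xs (Suc j) \<le> part xs (Suc i)"
  using assms sorted_wrt_nth_less[of "(\<ge>)" xs i j]
  by (cases "i = j") (auto simp: is_partition_def part_Suc)

lemma length_le_sum_list:
  assumes "is_partition xs"
  shows "length xs \<le> sum_list xs"
proof -
  have "\<forall>x\<in>set xs. 0 < x" using assms by (simp add: is_partition_def)
  then show ?thesis by (induction xs) fastforce+
qed

lemma part_inject:
  assumes "is_partition xs" "is_partition ys"
    and "\<And>i. part xs (Suc i) = part ys (Suc i)"
  shows "xs = ys"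
proof -
  have pos: "part zs (Suc i) \<noteq> 0 \<longleftrightarrow> i < length zs" if "is_partition zs" for zs i
    using that by (auto simp: is_partition_def part_Suc)
  have "i < length xs \<longleftrightarrow> i < length ys" for i
    using pos[OF assms(1)] pos[OF assms(2)] assms(3) by metis
  then have len: "length xs = length ys"
    by (metis linorder_neqE_nat less_irrefl)
  show ?thesis
  proof (rule nth_equalityI[OF len])
    show "xs ! i = ys ! i" if "i < length xs" for i
      using assms(3)[of i] that len by (simp add: part_Suc)
  qed
qed

lemma sum_part:
  assumes "length xs \<le> L"
  shows "(\<Sum>i<L. part xs (Suc i)) = sum_list xs"
proof -
  have "(\<Sum>i<L. part xs (Suc i)) = (\<Sum>i<length xs. part xs (Suc i))"
    using assms by (intro sum.mono_neutral_right) (auto simp: part_Suc)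
  also have "\<dots> = sum_list xs"
    by (simp add: part_Suc sum_list_sum_nth atLeast0LessThan)
  finally show ?thesis .
qed

text \<open>Zeros form a tail of a weakly decreasing list, and \<open>part\<close> is 0 beyond the
  end anyway.\<close>

lemma part_filter_pos:
  "sorted_wrt (\<ge>) ys \<Longrightarrow> part (filter (\<lambda>x. 0 < x) ys) (Suc i) = part ys (Suc i)"
proof (induction ys arbitrary: i)
  case (Cons y ys)
  show ?case
  proof (cases "y = 0")
    case True
    with Cons.prems have "\<forall>x\<in>set (y # ys). x = 0" by auto
    then have "filter (\<lambda>x. 0 < x) (y # ys) = []" and "part (y # ys) (Suc i) = 0"
      using nth_mem[of i "y # ys"] by (auto simp: part_Suc simp del: nth_mem)
    then show ?thesis by (simp add: part_Suc)
  next
    case False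
    have *: "part (y # zs) (Suc (Suc k)) = part zs (Suc k)" for zs k by (simp add: part_Suc)
    from False show ?thesis using Cons by (cases i) (simp add: part_Suc, simp add: *)
  qed
qed simp

text \<open>A beta number at a 0-based index, shifted by \<open>L\<close>; with this grouping the
  subtraction is exact for \<open>i < L\<close>.\<close>

definition bead :: "nat \<Rightarrow> nat list \<Rightarrow> nat \<Rightarrow> nat" where
  "bead L xs i = part xs (Suc i) + (L - Suc i)"

text \<open>The elements of the beta set that are at least \<open>-L\<close>, shifted up by \<open>L\<close>.\<close>
definition beads :: "nat \<Rightarrow> nat list \<Rightarrow> nat set" where
  "beads L xs = bead L xs ` {..<L}"

lemma bead_decreasing:
  assumes "is_partition xs" "i < j" "j < L"
  shows "bead L xs j < bead L xs i"
  using part_antimono[OF assms(1), of i j] assms by (simp add: bead_def)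

lemma inj_on_bead:
  assumes "is_partition xs"
  shows "inj_on (bead L xs) {..<L}"
proof (rule linorder_inj_onI)
  show "bead L xs i \<noteq> bead L xs j" if "i < j" "j \<in> {..<L}" for i j
    using bead_decreasing[OF assms, of i j L] that by simp
qed auto

text \<open>The index \<open>i\<close> is recovered as the number of values above \<open>f i\<close>.\<close>
lemma decreasing_enumeration_unique:
  fixes f g :: "nat \<Rightarrow> nat"
  assumes f: "\<And>i j. i < j \<Longrightarrow> j < L \<Longrightarrow> f j < f i"
    and g: "\<And>i j. i < j \<Longrightarrow> j < L \<Longrightarrow> g j < g i"
    and eq: "f ` {..<L} = g ` {..<L}" and i: "i < L"
  shows "f i = g i"
proof -
  have *: "card {x \<in> h ` {..<L}. h k < x} = k"
    if h: "\<And>i j. i < j \<Longrightarrow> j < L \<Longrightarrow> h j < h i" and k: "k < L" for h :: "nat \<Rightarrow> nat" and k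
  proof -
    have "h k < h j \<longleftrightarrow> j < k" if "j < L" for j
      using h[of j k] h[of k j] that k by (cases j k rule: linorder_cases) auto
    then have "{x \<in> h ` {..<L}. h k < x} = h ` {..<k}" using k by auto
    moreover have "inj_on h {..<k}"
    proof (rule linorder_inj_onI)
      show "h x \<noteq> h y" if "x < y" "y \<in> {..<k}" for x y
        using h[of x y] k that by simp
    qed auto
    ultimately show ?thesis by (simp add: card_image)
  qed
  from i eq obtain k where k: "k < L" "f i = g k" by blast
  have "card {x \<in> f ` {..<L}. f i < x} = i" by (rule *) (use f i in auto)
  moreover have "card {x \<in> g ` {..<L}. g k < x} = k" by (rule *) (use g k in auto)
  ultimately have "i = k" using eq k(2) by simp
  then show ?thesis using k by simp
qed

text \<open>The set determines its decreasing enumeration and so the first \<open>L\<close> parts; a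
  partition of \<open>n \<le> L\<close> has no further ones.\<close>

lemma inj_on_beads: "n \<le> L \<Longrightarrow> inj_on (beads L) (partitions n)"
proof (rule inj_onI)
  fix xs ys assume n: "n \<le> L" and xy: "xs \<in> partitions n" "ys \<in> partitions n" and eq: "beads L xs = beads L ys"
  then have p: "is_partition xs" "is_partition ys" and l: "length xs \<le> L" "length ys \<le> L"
    using length_le_sum_list[of xs] length_le_sum_list[of ys] by (auto simp: partitions_def)
  have b: "bead L xs i = bead L ys i" if "i < L" for i
    using decreasing_enumeration_unique[of L "bead L xs" "bead L ys" i] bead_decreasing[OF p(1)]
      bead_decreasing[OF p(2)] eq that unfolding beads_def by blast
  have "part xs (Suc i) = part ys (Suc i)" for i
    using b[of i] l by (cases "i < L") (auto simp: bead_def part_Suc)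
  then show "xs = ys" using part_inject p by blast
qed

lemma beads_in_sum_sets:
  assumes p: "is_partition xs" and l: "length xs \<le> L"
  shows "beads L xs \<in> sum_sets L (sum_list xs + L * (L - 1) div 2)"
proof -
  have "(\<Sum>i<L. L - Suc i) = L * (L - 1) div 2"
    using sum.nat_diff_reindex[of "\<lambda>i. i" L] Sum_Ico_nat[of 0 L] by (simp add: atLeast0LessThan)
  then have "\<Sum>(beads L xs) = sum_list xs + L * (L - 1) div 2"
    unfolding beads_def sum.reindex[OF inj_on_bead[OF p]]
    by (simp only: o_def bead_def sum.distrib sum_part[OF l])
  then show ?thesis
    using card_image[OF inj_on_bead[OF p, of L]] by (simp add: sum_sets_def beads_def)
qed

text \<open>Sort \<open>X\<close> decreasingly, subtract the staircase \<open>L-1, ..., 0\<close>,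
  and drop the resulting zeros.\<close>

lemma ex_partition_beads:
  assumes "X \<in> sum_sets L (n + L * (L - 1) div 2)"
  shows "\<exists>xs\<in>partitions n. beads L xs = X"
proof -
  have X: "finite X" "card X = L" using assms by (auto simp: sum_sets_def)
  define l where "l = rev (sorted_list_of_set X)"
  have l: "length l = L" "set l = X" using X by (simp_all add: l_def)
  have "sorted_wrt (>) l"
    using strict_sorted_list_of_set[of X] by (simp add: l_def sorted_wrt_rev)
  then have dec: "l ! j < l ! i" if "i < j" "j < L" for i j
    using that l sorted_wrt_nth_less[of "(>)" l i j] by simp
  \<comment> \<open>At least \<open>L - 1 - i\<close> distinct naturals lie below the entry at index
    \<open>i\<close>, so the subtraction in \<open>ys\<close> is exact. The induction starts from
    the last index.\<close>
  have lower: "L - Suc i \<le> l ! i" if "i < L" for i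
    using that
  proof (induction "L - Suc i" arbitrary: i)
    case (Suc k)
    then have "k = L - Suc (Suc i)" "Suc i < L" by auto
    then show ?case using Suc.hyps(1)[of "Suc i"] dec[of i "Suc i"] by linarith
  qed simp
  define ys where "ys = map (\<lambda>i. l ! i - (L - Suc i)) [0..<L]"
  define xs where "xs = filter (\<lambda>x. 0 < x) ys"
  have "l ! j - (L - Suc j) \<le> l ! i - (L - Suc i)" if "i < j" "j < L" for i j
    using that
  proof (induction j)
    case (Suc j)
    have "l ! Suc j - (L - Suc (Suc j)) \<le> l ! j - (L - Suc j)"
      using dec[of j "Suc j"] Suc.prems by linarith
    then show ?case using Suc by (cases "i = j") (simp, linarith)
  qed simp
  then have sorted: "sorted_wrt (\<ge>) ys"
    by (auto simp: ys_def sorted_wrt_iff_nth_less)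
  then have p: "is_partition xs"
    by (simp add: is_partition_def xs_def sorted_wrt_filter)
  have len: "length xs \<le> L"
    using length_filter_le[of "\<lambda>x. 0 < x" ys] by (simp add: xs_def ys_def)
  have "bead L xs i = l ! i" if "i < L" for i
    using that lower[OF that] part_filter_pos[OF sorted, of i]
    by (simp add: bead_def xs_def[symmetric] part_Suc[of ys]) (simp add: ys_def)
  then have b: "beads L xs = X"
    unfolding beads_def using l by (auto simp: in_set_conv_nth image_iff)
  have "xs \<in> partitions (sum_list xs)" using p by (simp add: partitions_def)
  moreover have "sum_list xs = n"
    using beads_in_sum_sets[OF p len] assms unfolding b sum_sets_def by simp
  ultimately show ?thesis using b by blast
qed

text \<open>As \<open>2M\<close> is even, the bead at index \<open>i\<close> is even iff exactly one
  of the part and \<open>i\<close> is odd. Each signed parity is thus the indicator of an even bead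
  minus that of an odd index, and there are \<open>M\<close> odd indices.\<close>

lemma bg_rank_eq_card_even_beads:
  assumes p: "is_partition xs" and l: "length xs \<le> 2 * M"
  shows "bg_rank xs = int (card {x \<in> beads (2 * M) xs. even x}) - int M"
proof -
  let ?b = "bead (2 * M) xs"
  have "bg_rank xs = (\<Sum>i<length xs. (-1) ^ i * par (part xs (Suc i)))"
    unfolding bg_rank_def image_Suc_lessThan[symmetric]
    by (subst sum.reindex) simp_all
  also have "\<dots> = (\<Sum>i<2*M. (-1) ^ i * par (part xs (Suc i)))"
    using l by (intro sum.mono_neutral_left) (auto simp: part_Suc par_def)
  also have "\<dots> = (\<Sum>i<2*M. of_bool (even (?b i)) - of_bool (odd i))"
  proof (rule sum.cong[OF refl])
    fix i assume "i \<in> {..<2*M}"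
    then have "even (2 * M - Suc i) \<longleftrightarrow> odd i" by auto
    then have "even (?b i) \<longleftrightarrow> (even (part xs (Suc i)) \<longleftrightarrow> odd i)"
      by (simp add: bead_def)
    then show "(-1) ^ i * par (part xs (Suc i)) = of_bool (even (?b i)) - of_bool (odd i)"
      by (auto simp: par_def)
  qed
  also have "\<dots> = (\<Sum>i<2*M. of_bool (even (?b i))) - (\<Sum>i<2*M. of_bool (odd i))"
    by (simp add: sum_subtractf)
  also have "(\<Sum>i<2*M. of_bool (odd i)) = int M"
    by (induction M) auto
  also have "(\<Sum>i<2*M. of_bool (even (?b i))) = (\<Sum>x\<in>beads (2*M) xs. of_bool (even x))"
    unfolding beads_def sum.reindex[OF inj_on_bead[OF p]] by simp
  also have "\<dots> = int (card {x \<in> beads (2*M) xs. even x})"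
    by (simp add: beads_def Int_def)
  finally show ?thesis .
qed

section \<open>Even and odd halves of a bead set\<close>

definition half :: "nat \<Rightarrow> nat set \<Rightarrow> nat set" where
  "half c X = {y. 2 * y + c \<in> X}"

definition interleave :: "nat set \<Rightarrow> nat set \<Rightarrow> nat set" where
  "interleave Y Z = (\<lambda>y. 2 * y) ` Y \<union> (\<lambda>y. 2 * y + 1) ` Z"

lemma half_interleave [simp]:
  "half 0 (interleave Y Z) = Y" "half (Suc 0) (interleave Y Z) = Z"
proof -
  have "2 * y \<noteq> 2 * z + 1" "2 * z + 1 \<noteq> 2 * y" for y z :: nat by presburger+
  then show "half 0 (interleave Y Z) = Y" "half (Suc 0) (interleave Y Z) = Z"
    unfolding half_def interleave_def by auto
qed

lemma interleave_half: "interleave (half 0 X) (half 1 X) = X"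
proof (rule set_eqI)
  fix x
  show "x \<in> interleave (half 0 X) (half 1 X) \<longleftrightarrow> x \<in> X"
    by (cases "even x") (auto simp: interleave_def half_def elim!: evenE oddE)
qed

lemma
  assumes "finite Y" "finite Z"
  shows finite_interleave: "finite (interleave Y Z)"
    and card_interleave: "card (interleave Y Z) = card Y + card Z"
    and sum_interleave: "\<Sum>(interleave Y Z) = 2 * (\<Sum>Y + \<Sum>Z) + card Z"
    and card_even_interleave: "card {x \<in> interleave Y Z. even x} = card Y"
proof -
  let ?f = "\<lambda>y::nat. 2 * y" and ?g = "\<lambda>y::nat. 2 * y + 1"
  have inj: "inj_on ?f Y" "inj_on ?g Z" by (auto simp: inj_on_def)
  have disj: "?f ` Y \<inter> ?g ` Z = {}" by auto presburger
  show "finite (interleave Y Z)" using assms by (simp add: interleave_def)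
  show "card (interleave Y Z) = card Y + card Z"
    unfolding interleave_def using assms disj inj
    by (subst card_Un_disjoint) (simp_all add: card_image)
  have "\<Sum>(interleave Y Z) = \<Sum>(?f ` Y) + \<Sum>(?g ` Z)"
    unfolding interleave_def using assms disj by (intro sum.union_disjoint) auto
  also have "\<dots> = 2 * (\<Sum>Y + \<Sum>Z) + card Z"
    unfolding sum.reindex[OF inj(1)] sum.reindex[OF inj(2)]
    by (simp only: o_def sum.distrib sum_distrib_left[symmetric] sum_constant) simp
  finally show "\<Sum>(interleave Y Z) = 2 * (\<Sum>Y + \<Sum>Z) + card Z" .
  have "{x \<in> interleave Y Z. even x} = ?f ` Y" by (auto simp: interleave_def)
  then show "card {x \<in> interleave Y Z. even x} = card Y" using inj by (simp add: card_image)
qed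

lemma finite_half: "finite X \<Longrightarrow> finite (half c X)"
  unfolding half_def using finite_vimageI[of X "\<lambda>y. 2 * y + c"] by (simp add: inj_on_def vimage_def)

section \<open>The 2-quotient read off from the beads\<close>

lemma mem_beta_set_iff:
  assumes "length xs \<le> L"
  shows "v \<in> beta_set xs \<longleftrightarrow> v < - int L \<or> v \<ge> - int L \<and> nat (v + int L) \<in> beads L xs"
proof -
  have "v \<in> beta_set xs \<longleftrightarrow> (\<exists>i. v = int (part xs (Suc i)) - int (Suc i))"
  proof
    assume "v \<in> beta_set xs"
    then obtain j where "v = int (part xs j) - int j" "1 \<le> j" by (auto simp: beta_set_def)
    then show "\<exists>i. v = int (part xs (Suc i)) - int (Suc i)" by (intro exI[of _ "j - 1"]) simp
  qed (force simp: beta_set_def)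
  \<comment> \<open>From index \<open>L\<close> on all parts are 0, so these beta numbers fill the
    integers below \<open>-L\<close>.\<close>
  also have "\<dots> \<longleftrightarrow> (\<exists>i\<ge>L. v = - int (Suc i)) \<or> (\<exists>i<L. v + int L = int (bead L xs i))"
    (is "?l \<longleftrightarrow> ?r")
  proof -
    have "v = int (part xs (Suc i)) - int (Suc i) \<longleftrightarrow>
       (if i \<ge> L then v = - int (Suc i) else v + int L = int (bead L xs i))" for i
      using assms by (auto simp: bead_def part_Suc of_nat_diff)
    moreover have "(\<exists>i. if i \<ge> L then P i else Q i) \<longleftrightarrow> (\<exists>i\<ge>L. P i) \<or> (\<exists>i<L. Q i)" for P Q
      by (meson not_le)
    ultimately show ?thesis by presburger
  qed
  also have "(\<exists>i\<ge>L. v = - int (Suc i)) \<longleftrightarrow> v < - int L"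
  proof
    assume "v < - int L"
    then show "\<exists>i\<ge>L. v = - int (Suc i)" by (intro exI[of _ "nat (- v - 1)"]) auto
  qed auto
  also have "(\<exists>i<L. v + int L = int (bead L xs i)) \<longleftrightarrow> v \<ge> - int L \<and> nat (v + int L) \<in> beads L xs"
    by (auto simp: beads_def image_iff)
  finally show ?thesis .
qed

text \<open>The even shift \<open>2M\<close> respects parity and becomes a shift by \<open>M\<close>
  after halving.\<close>

lemma mem_S_c_iff:
  assumes "length xs \<le> 2 * M" "c \<le> 1"
  shows "k \<in> S_c xs (int c) \<longleftrightarrow> k < - int M \<or> k \<ge> - int M \<and> nat (k + int M) \<in> half c (beads (2 * M) xs)"
proof -
  have "nat (2 * k + int c + int (2 * M)) = 2 * nat (k + int M) + c" if "k \<ge> - int M"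
    using that by simp
  moreover have "2 * k + int c < - int (2 * M) \<longleftrightarrow> k < - int M" using assms(2) by auto
  ultimately show ?thesis
    unfolding S_c_def mem_Collect_eq mem_beta_set_iff[OF assms(1)] half_def by auto
qed

lemma quot_nu_eq_gaps:
  assumes "length xs \<le> 2 * M" "c \<le> 1"
  shows "quot_nu xs (int c) = gaps (half c (beads (2 * M) xs))"
proof -
  let ?Y = "half c (beads (2 * M) xs)"
  let ?h = "\<lambda>y. int y - int M"
  note S = mem_S_c_iff[OF assms]
  \<comment> \<open>Since \<open>card\<close> is 0 on infinite sets, finiteness is what lets
    positivity in \<open>quot_part_index\<close> mean the existence of a larger element.\<close>
  have fin: "finite {s \<in> S_c xs (int c). g < s}" for g
  proof (rule finite_subset)
    show "{s \<in> S_c xs (int c). g < s} \<subseteq> {g<..<- int M} \<union> ?h ` ?Y"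
    proof
      fix s assume s: "s \<in> {s \<in> S_c xs (int c). g < s}"
      show "s \<in> {g<..<- int M} \<union> ?h ` ?Y"
      proof (cases "s < - int M")
        case False
        then have "nat (s + int M) \<in> ?Y" "s = ?h (nat (s + int M))" using s S by auto
        then show ?thesis by blast
      qed (use s in auto)
    qed
    show "finite ({g<..<- int M} \<union> ?h ` ?Y)"
      by (simp add: finite_half beads_def)
  qed
  have "quot_part_index xs (int c) = {g. g \<notin> S_c xs (int c) \<and> (\<exists>s\<in>S_c xs (int c). g < s)}"
    unfolding quot_part_index_def card_gt_0_iff using fin by blast
  also have "\<dots> = ?h ` {g. g \<notin> ?Y \<and> (\<exists>s\<in>?Y. g < s)}"
  proof (intro equalityI subsetI)
    fix g assume "g \<in> {g. g \<notin> S_c xs (int c) \<and> (\<exists>s\<in>S_c xs (int c). g < s)}"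
    then obtain s where g: "g \<ge> - int M" "nat (g + int M) \<notin> ?Y" and s: "s \<in> S_c xs (int c)" "g < s"
      using S[of g] by auto
    then have "nat (s + int M) \<in> ?Y" "nat (g + int M) < nat (s + int M)" using S[of s] by auto
    then have "nat (g + int M) \<in> {g. g \<notin> ?Y \<and> (\<exists>s\<in>?Y. g < s)}" using g by blast
    moreover have "g = ?h (nat (g + int M))" using g by simp
    ultimately show "g \<in> ?h ` {g. g \<notin> ?Y \<and> (\<exists>s\<in>?Y. g < s)}" by blast
  next
    fix g assume "g \<in> ?h ` {g. g \<notin> ?Y \<and> (\<exists>s\<in>?Y. g < s)}"
    then obtain g' s where "g = ?h g'" "g' \<notin> ?Y" "s \<in> ?Y" "g' < s" by auto
    then have "g \<notin> S_c xs (int c)" "?h s \<in> S_c xs (int c)" "g < ?h s"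
      using S[of g] S[of "?h s"] by auto
    then show "g \<in> {g. g \<notin> S_c xs (int c) \<and> (\<exists>s\<in>S_c xs (int c). g < s)}" by blast
  qed
  finally have "card (quot_part_index xs (int c)) = gaps ?Y"
    by (simp add: gaps_def card_image inj_on_def)
  then show ?thesis by (simp add: quot_nu_def quot_parts_def)
qed

lemma two_quotient_rank_eq_gaps:
  assumes "length xs \<le> 2 * M"
  shows "two_quotient_rank xs =
    int (gaps (half 0 (beads (2 * M) xs))) - int (gaps (half 1 (beads (2 * M) xs)))"
  using quot_nu_eq_gaps[OF assms, of 0] quot_nu_eq_gaps[OF assms, of 1]
  by (simp add: two_quotient_rank_def)

text \<open>The count \<open>a = M + j\<close> of even beads encodes the BG-rank. The bead sum
  \<open>n + M(2M-1)\<close> equals \<open>2t + b\<close>, as each of the \<open>b\<close> odd beads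
  adds 1 to twice its half.\<close>

lemma bij_betw_halves:
  assumes n: "n \<le> 2 * M" and a: "int a = int M + j" and b: "int b = int M - j"
    and t: "2 * t + b = n + M * (2 * M - 1)"
  shows "bij_betw (\<lambda>xs. (half 0 (beads (2 * M) xs), half 1 (beads (2 * M) xs)))
    {xs \<in> partitions n. bg_rank xs = j} (sum_set_pairs a b t)"
  unfolding bij_betw_def
proof (intro conjI equalityI subsetI)
  let ?\<Phi> = "\<lambda>xs. (half 0 (beads (2 * M) xs), half 1 (beads (2 * M) xs))"
  let ?A = "{xs \<in> partitions n. bg_rank xs = j}"
  have ab: "a + b = 2 * M" using a b by linarith
  have tri: "2 * M * (2 * M - 1) div 2 = M * (2 * M - 1)" by simp
  have inj: "inj_on (beads (2 * M)) ?A"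
    using inj_on_beads[OF n] by (rule inj_on_subset) auto
  show "inj_on ?\<Phi> ?A"
  proof (rule inj_onI)
    fix xs ys assume "xs \<in> ?A" "ys \<in> ?A" "?\<Phi> xs = ?\<Phi> ys"
    then show "xs = ys" using inj interleave_half by (metis (no_types, lifting) inj_onD prod.inject)
  qed
  have iff: "(half 0 X, half 1 X) \<in> sum_set_pairs a b t \<longleftrightarrow>
      X \<in> sum_sets (2 * M) (n + M * (2 * M - 1)) \<and> int (card {x \<in> X. even x}) - int M = j"
    if "finite X" for X
  proof -
    let ?Y = "half 0 X" and ?Z = "half 1 X"
    have "finite ?Y" "finite ?Z" using that by (simp_all add: finite_half)
    from card_interleave[OF this] sum_interleave[OF this] card_even_interleave[OF this] this
    show ?thesis
      unfolding interleave_half sum_set_pairs_def sum_sets_def mem_Collect_eq prod.case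
      using that ab a b t by auto
  qed
  have len: "length xs \<le> 2 * M" if "xs \<in> partitions n" for xs
    using length_le_sum_list[of xs] that n by (auto simp: partitions_def)
  {
    fix p assume "p \<in> ?\<Phi> ` ?A"
    then obtain xs where xs: "xs \<in> partitions n" "bg_rank xs = j" and p: "p = ?\<Phi> xs" by blast
    then have "is_partition xs" "sum_list xs = n" by (auto simp: partitions_def)
    with beads_in_sum_sets[OF _ len[OF xs(1)]] bg_rank_eq_card_even_beads[OF _ len[OF xs(1)]] xs(2)
    show "p \<in> sum_set_pairs a b t"
      unfolding p tri by (subst iff) (auto simp: beads_def)
  }
  fix p assume p: "p \<in> sum_set_pairs a b t"
  obtain Y Z where YZ: "p = (Y, Z)" by (cases p)
  let ?X = "interleave Y Z"
  have "finite Y" "finite Z" using p by (auto simp: YZ sum_set_pairs_def)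
  then have "finite ?X" by (rule finite_interleave)
  from iff[OF this] p have X: "?X \<in> sum_sets (2 * M) (n + M * (2 * M - 1))"
    and e: "int (card {x \<in> ?X. even x}) - int M = j"
    by (simp_all add: YZ)
  from ex_partition_beads[of ?X "2 * M" n] X obtain xs where xs: "xs \<in> partitions n" "beads (2 * M) xs = ?X"
    unfolding tri by auto
  then have "bg_rank xs = j"
    using bg_rank_eq_card_even_beads[OF _ len[OF xs(1)]] e by (simp add: partitions_def)
  moreover have "p = ?\<Phi> xs" using xs by (simp add: YZ)
  ultimately show "p \<in> ?\<Phi> ` ?A" using xs(1) by blast
qed

text \<open>\<open>j(2j-1)\<close> is the size of the 2-core for BG-rank \<open>j\<close>, and
  \<open>N\<close> is the total size of the 2-quotient.\<close>

lemma sum_fifth_root_two_quotient_rank_eq_0: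
  fixes z :: "'a::field"
  assumes z: "z ^ 5 = 1" "z \<noteq> 1"
    and N: "\<And>N. int n = 2 * int N + j * (2 * j - 1) \<Longrightarrow> N mod 5 \<notin> {0, 1}"
  shows "(\<Sum>xs | xs \<in> partitions n \<and> bg_rank xs = j. z powi two_quotient_rank xs) = 0"
proof -
  let ?A = "{xs \<in> partitions n. bg_rank xs = j}"
  \<comment> \<open>Large enough that both \<open>a\<close> and \<open>b\<close> are at least
    \<open>n\<close>, hence at least \<open>N\<close>.\<close>
  define M where "M = n + nat \<bar>j\<bar>"
  define a where "a = nat (int M + j)"
  define b where "b = nat (int M - j)"
  define t where "t = (n + M * (2 * M - 1) - b) div 2"
  have n: "n \<le> 2 * M" by (simp add: M_def)
  have a: "int a = int M + j" and b: "int b = int M - j" by (auto simp: M_def a_def b_def)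
  have nab: "n \<le> a" "n \<le> b" by (auto simp: M_def a_def b_def)
  have z0: "z \<noteq> 0" using z by auto
  have len: "length xs \<le> 2 * M" if "xs \<in> partitions n" for xs
    using length_le_sum_list[of xs] that n by (auto simp: partitions_def)
  show ?thesis
  \<comment> \<open>The division defining \<open>t\<close> may be inexact. Then no partition of
    \<open>n\<close> has BG-rank \<open>j\<close>, since its bead sum would make the division
    exact.\<close>
  proof (cases "2 * t + b = n + M * (2 * M - 1)")
    case True
    let ?\<Phi> = "\<lambda>xs. (half 0 (beads (2 * M) xs), half 1 (beads (2 * M) xs))"
    have "(\<Sum>xs\<in>?A. z powi two_quotient_rank xs) =
      (\<Sum>xs\<in>?A. case ?\<Phi> xs of (Y, Z) \<Rightarrow> z ^ gaps Y * inverse z ^ gaps Z)"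
      by (rule sum.cong[OF refl])
        (use z0 in \<open>simp add: two_quotient_rank_eq_gaps[OF len] power_int_diff power_inverse divide_inverse\<close>)
    also have "\<dots> = (\<Sum>(Y, Z)\<in>sum_set_pairs a b t. z ^ gaps Y * inverse z ^ gaps Z)"
      by (rule sum.reindex_bij_betw[OF bij_betw_halves[OF n a b True]])
    also have "\<dots> = 0"
    proof (rule sum_gaps_fifth_root_eq_0[OF z])
      fix N assume t: "t = N + (a * (a - 1) div 2 + b * (b - 1) div 2)"
      have tri: "2 * int (k * (k - 1) div 2) = int k * (int k - 1)" for k :: nat
        by (cases k) (simp_all add: of_nat_div algebra_simps flip: of_nat_mult of_nat_add)
      have "int (M * (2 * M - 1)) = int M * (2 * int M - 1)" by (cases M) (simp_all add: algebra_simps)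
      then have "int n = 2 * int t + int b - int M * (2 * int M - 1)"
        using arg_cong[OF True, of int] by simp
      also have "2 * int t = 2 * int N + int a * (int a - 1) + int b * (int b - 1)"
        unfolding t using tri[of a] tri[of b] by simp
      finally have *: "int n = 2 * int N + j * (2 * j - 1)"
        unfolding a b by (simp add: algebra_simps)
      have "0 \<le> j * (2 * j - 1)" by (cases "j \<le> 0") (auto simp: mult_nonpos_nonpos)
      then have "N \<le> n" using * by linarith
      then show "N \<le> a \<and> N \<le> b \<and> N mod 5 \<notin> {0, 1}" using nab N[OF *] by auto
    qed
    finally show ?thesis by simp
  next
    case False
    have "xs \<notin> ?A" for xs
    proof
      assume xs: "xs \<in> ?A"
      let ?X = "beads (2 * M) xs"
      let ?Y = "half 0 ?X" and ?Z = "half 1 ?X"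
      have p: "is_partition xs" "sum_list xs = n" "length xs \<le> 2 * M" using xs len by (auto simp: partitions_def)
      have fin: "finite ?Y" "finite ?Z" by (simp_all add: finite_half beads_def)
      have "card ?X = 2 * M" "\<Sum>?X = n + M * (2 * M - 1)"
        using beads_in_sum_sets[OF p(1,3)] p(2) by (simp_all add: sum_sets_def)
      moreover have "card ?Z = b"
        using card_interleave[OF fin] card_even_interleave[OF fin] bg_rank_eq_card_even_beads[OF p(1,3)] b xs
          \<open>card ?X = 2 * M\<close> unfolding interleave_half by auto
      ultimately have "2 * (\<Sum>?Y + \<Sum>?Z) + b = n + M * (2 * M - 1)"
        using sum_interleave[OF fin] unfolding interleave_half by simp
      then show False using False unfolding t_def by (metis add_diff_cancel_right' nonzero_mult_div_cancel_left zero_neq_numeral)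
    qed
    then show ?thesis by (intro sum.neutral) blast
  qed
qed

lemma finite_partitions: "finite (partitions n)"
proof (rule inj_on_finite[OF inj_on_beads[of n n]])
  show "beads n ` partitions n \<subseteq> sum_sets n (n + n * (n - 1) div 2)"
  proof (rule image_subsetI)
    fix xs assume "xs \<in> partitions n"
    then show "beads n xs \<in> sum_sets n (n + n * (n - 1) div 2)"
      using beads_in_sum_sets[of xs n] length_le_sum_list[of xs] by (simp add: partitions_def)
  qed
qed (simp_all add: finite_sum_sets)

section \<open>Equidistribution\<close>

text \<open>Since 5 is prime, \<open>w^r = 1\<close> with \<open>0 < r < 5\<close> together with
  \<open>w^5 = 1\<close> would force \<open>w = 1\<close>.\<close>

lemma fifth_root_power_neq_1:
  fixes w :: "'a::field"
  assumes w: "w ^ 5 = 1" "w \<noteq> 1" and k: "k mod 5 \<noteq> 0"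
  shows "w ^ k \<noteq> 1"
proof
  assume 1: "w ^ k = 1"
  have "w ^ (5 * (k div 5) + k mod 5) = w ^ (k mod 5)"
    unfolding power_add power_mult w(1) by simp
  then have r: "w ^ (k mod 5) = 1" using 1 by simp
  have "k mod 5 < 5" by simp
  then consider "k mod 5 = 1" | "k mod 5 = 2" | "k mod 5 = 3" | "k mod 5 = 4"
    using k by linarith
  then show False
  proof cases
    case 1 then show False using r w by simp
  next
    case 2
    have "w ^ 5 = w ^ 2 * w ^ 2 * w" by (simp flip: power_add power_Suc2)
    also have "w ^ 2 = 1" using r 2 by simp
    finally show False using w by simp
  next
    case 3
    have "w ^ 5 * w = w ^ 3 * w ^ 3" by (simp flip: power_add power_Suc2)
    also have "w ^ 3 = 1" using r 3 by simp
    finally show False using w by simp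
  next
    case 4
    have "w ^ 5 = w ^ 4 * w" by (simp flip: power_Suc2)
    then show False using w r 4 by simp
  qed
qed

lemma exists_fifth_root: "\<exists>w::complex. w ^ 5 = 1 \<and> w \<noteq> 1"
proof (intro exI conjI)
  let ?w = "cis (2 * pi / 5)"
  show "?w ^ 5 = 1" by (simp add: DeMoivre)
  show "?w \<noteq> 1"
  proof
    assume "?w = 1"
    then have "cos (2 * pi / 5) = 1" by (simp add: complex_eq_iff)
    moreover have "cos (2 * pi / 5) < cos 0" by (rule cos_monotone_0_pi) auto
    ultimately show False by simp
  qed
qed

text \<open>Root-of-unity filter: summing \<open>w^(i(rank - m))\<close> over \<open>i < 5\<close>
  gives 5 or 0 according to the congruence. After swapping the sums only \<open>i = 0\<close>
  survives, and it counts all partitions.\<close>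

lemma Pbar_eq_pbar:
  assumes N: "\<And>N. int n = 2 * int N + j * (2 * j - 1) \<Longrightarrow> N mod 5 \<notin> {0, 1}"
  shows "real (Pbar j m n) = real (pbar j n) / 5"
proof -
  obtain w :: complex where w: "w ^ 5 = 1" "w \<noteq> 1" using exists_fifth_root by blast
  then have w0: "w \<noteq> 0" by auto
  let ?A = "{xs \<in> partitions n. bg_rank xs = j}"
  let ?P = "\<lambda>xs. two_quotient_rank xs mod 5 = m mod 5"
  have fin: "finite ?A" using finite_partitions by simp
  define g where "g xs = w powi (two_quotient_rank xs - m)" for xs
  have g: "(\<Sum>i<5. g xs ^ i) = (if ?P xs then 5 else 0)" for xs
  proof -
    define k where "k = (two_quotient_rank xs - m) mod 5"
    define d where "d = (two_quotient_rank xs - m) div 5"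
    have k: "two_quotient_rank xs - m = 5 * d + int (nat k)" "0 \<le> k" "k < 5"
      by (simp_all add: k_def d_def)
    have "w powi (5 * d + int (nat k)) = w powi (5 * d) * w powi int (nat k)"
      by (rule power_int_add) (simp add: w0)
    also have "w powi (5 * d) = (w powi 5) powi d" by (rule power_int_mult)
    finally have "g xs = w ^ nat k"
      unfolding g_def k(1) by (simp only: w power_int_of_nat power_int_numeral power_int_1_left mult_1_left)
    moreover have "?P xs \<longleftrightarrow> k = 0"
      by (simp add: k_def mod_eq_dvd_iff dvd_eq_mod_eq_0)
    moreover have "(\<Sum>i<5. (w ^ nat k) ^ i) = 0" if "k \<noteq> 0"
    proof -
      have "nat k mod 5 \<noteq> 0" using k that by auto
      moreover have "(w ^ nat k) ^ 5 = (w ^ 5) ^ nat k"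
        by (simp only: power_mult[symmetric] mult.commute)
      ultimately have "1 + w ^ nat k + (w ^ nat k)\<^sup>2 + (w ^ nat k) ^ 3 + (w ^ nat k) ^ 4 = 0"
        using w by (intro fifth_root_sum_eq_0 fifth_root_power_neq_1) simp_all
      moreover have "{..<5::nat} = {0, 1, 2, 3, 4}" by auto
      ultimately show ?thesis by (simp add: add.assoc)
    qed
    ultimately show ?thesis by (cases "k = 0") simp_all
  qed
  \<comment> \<open>For \<open>0 < i < 5\<close> the power \<open>w^i\<close> is again a nontrivial
    fifth root of unity; the constant factor depending on \<open>m\<close> leaves the sum.\<close>
  have z: "(\<Sum>xs\<in>?A. g xs ^ i) = 0" if "i \<in> {..<5} - {0}" for i
  proof -
    have "(w ^ i) ^ 5 = (w ^ 5) ^ i"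
      by (simp only: power_mult[symmetric] mult.commute)
    then have wi: "(w ^ i) ^ 5 = 1" by (simp add: w)
    have "g xs ^ i = (w ^ i) powi (- m) * (w ^ i) powi two_quotient_rank xs" for xs
    proof -
      have "g xs ^ i = w powi (int i * (- m) + int i * two_quotient_rank xs)"
        by (simp add: g_def power_int_power' algebra_simps)
      also have "\<dots> = w powi (int i * (- m)) * w powi (int i * two_quotient_rank xs)"
        by (rule power_int_add) (simp add: w0)
      finally show ?thesis by (simp only: power_int_power)
    qed
    then have "(\<Sum>xs\<in>?A. g xs ^ i) = (w ^ i) powi (- m) * (\<Sum>xs\<in>?A. (w ^ i) powi two_quotient_rank xs)"
      by (simp add: sum_distrib_left)
    also have "(\<Sum>xs\<in>?A. (w ^ i) powi two_quotient_rank xs) = 0"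
      using that by (intro sum_fifth_root_two_quotient_rank_eq_0[OF _ _ N] fifth_root_power_neq_1[OF w])
        (simp_all add: wi)
    finally show ?thesis by simp
  qed
  have "of_nat (5 * card {xs \<in> ?A. ?P xs}) = (\<Sum>xs\<in>?A. if ?P xs then 5 else (0::complex))"
    using fin by (simp add: sum.If_cases Int_def)
  also have "\<dots> = (\<Sum>i<5. \<Sum>xs\<in>?A. g xs ^ i)"
    unfolding g[symmetric] by (rule sum.swap)
  also have "\<dots> = (\<Sum>xs\<in>?A. g xs ^ 0)"
    using z by (subst sum.remove[of _ 0]) auto
  also have "\<dots> = of_nat (card ?A)" by simp
  finally have "5 * card {xs \<in> ?A. ?P xs} = card ?A" unfolding of_nat_eq_iff .
  moreover have "{xs \<in> ?A. ?P xs} = {xs \<in> partitions n. bg_rank xs = j \<and> ?P xs}" by auto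
  ultimately have "5 * Pbar j m n = pbar j n" by (simp add: Pbar_def pbar_def)
  then show ?thesis by linarith
qed

lemma core_size_mod_5:
  "(j * (2 * j - 1)) mod 5 = (if j mod 5 \<in> {0, 3} then 0 else if j mod 5 \<in> {1, 2} then 1 else (3::int))"
proof -
  define q r where "q = j div 5" and "r = j mod 5"
  have j: "j = 5 * q + r" and r: "0 \<le> r" "r < 5" by (simp_all add: q_def r_def)
  have "j * (2 * j - 1) = 5 * (q * (10 * q + 4 * r - 1)) + r * (2 * r - 1)"
    by (simp add: j algebra_simps)
  then have *: "(j * (2 * j - 1)) mod 5 = (r * (2 * r - 1)) mod 5"
    by (simp only: mod_mult_self4)
  have "r = 0 \<or> r = 1 \<or> r = 2 \<or> r = 3 \<or> r = 4" using r by linarith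
  then show ?thesis unfolding * r_def[symmetric] by auto
qed

theorem theorem5:
  fixes j m :: int and n :: nat
  assumes "m \<in> {0, 1, 2, 3, 4}"
  shows "(j mod 5 \<in> {1, 2} \<longrightarrow> real (Pbar j m (5*n)) = real (pbar j (5*n)) / 5)
       \<and> (j mod 5 \<notin> {1, 2} \<longrightarrow> real (Pbar j m (5*n+1)) = real (pbar j (5*n+1)) / 5)
       \<and> (j mod 5 \<notin> {0, 3} \<longrightarrow> real (Pbar j m (5*n+2)) = real (pbar j (5*n+2)) / 5)
       \<and> (j mod 5 \<in> {0, 3} \<longrightarrow> real (Pbar j m (5*n+3)) = real (pbar j (5*n+3)) / 5)
       \<and> real (Pbar j m (5*n+4)) = real (pbar j (5*n+4)) / 5"
proof -
  define c where "c = j * (2 * j - 1)"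
  have c: "c mod 5 = (if j mod 5 \<in> {0, 3} then 0 else if j mod 5 \<in> {1, 2} then 1 else 3)"
    unfolding c_def by (rule core_size_mod_5)
  \<comment> \<open>\<open>N\<close> is 0 or 1 modulo 5 exactly when \<open>2N = k - c\<close> is 0
    or 2. As \<open>c\<close> is 0, 1 or 3 modulo 5, sizes congruent to 4 avoid both residues for
    every \<open>j\<close>.\<close>
  have "real (Pbar j m k) = real (pbar j k) / 5" if "(int k - c) mod 5 \<notin> {0, 2}" for k
  proof (rule Pbar_eq_pbar)
    fix N assume "int k = 2 * int N + j * (2 * j - 1)"
    then have "int k - c = 2 * int N" by (simp add: c_def)
    with that show "N mod 5 \<notin> {0, 1}" by (simp only: insert_iff empty_iff) presburger
  qed
  moreover have "(int (5 * n + r) - c) mod 5 = (int r - c mod 5) mod 5" for r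
  proof -
    have "int (5 * n + r) - c = 5 * int n + (int r - c)" by simp
    then show ?thesis by (simp only: mod_mult_self4 mod_diff_right_eq)
  qed
  ultimately have *: "real (Pbar j m (5*n+r)) = real (pbar j (5*n+r)) / 5"
    if "(int r - c mod 5) mod 5 \<notin> {0, 2}" for r
    using that by simp
  show ?thesis
    using *[of 0] *[of 1] *[of 2] *[of 3] *[of 4] unfolding c by (auto split: if_splits)
qed

end
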